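(* Let $f,g:\mathbb{R}^n\to\mathbb{R}\cup\{\infty\}$ be closed, proper, convex functions, let $\gamma>0$, $z^0\in\mathbb{R}^n$, and let $x^{k+1/2},x^{k+1},z^{k+1}$ ($k=0,1,\dots$) be the DRS iterates. Suppose $d^\star=p^\star=-\infty$, the primal problem (P) is feasible, but (P) has no primal improving direction. Then the dual problem (D) is weakly infeasible, $x^{k+1}-x^{k+1/2}\to 0$, \[ \lim_{k\to\infty}\frac{1}{k+1}\sum_{i=0}^{k}\bigl(f(x^{i+1/2})+g(x^{i+1})\bigr)=-\infty,\qquad \liminf_{k\to\infty}\bigl(f(x^{k+1/2})+g(x^{k+1})\bigr)=-\infty , \] and the sequence $(x^{k+1/2},x^{k+1})_{k\ge 0}$ does not converge.
   Context: A convex function is closed if its epigraph is closed, and proper if it is finite somewhere. $\mathrm{dom} f=\{x: f(x)<\infty\}$. $f^*(\nu)=\sup_x\{\langle \nu,x\rangle-f(x)\}$ is the convex conjugate. The recession function of a closed proper convex $f$ is $\mathrm{rec} f(d)=\lim_{\alpha\to\infty}\frac{f(x+\alpha d)-f(x)}{\alpha}$ for any $x\in\mathrm{dom} f$ (the value does not depend on $x$). Primal problem (P): minimize $f(x)+g(x)$ over $x\in\mathbb{R}^n$, with optimal value $p^\star=\inf_x\{f(x)+g(x)\}\in[-\infty,\infty]$. It is feasible if $\mathrm{dom} f\cap\mathrm{dom} g\neq\emptyset$. Dual problem (D): maximize $-f^*(\nu)-g^*(-\nu)$ over $\nu\in\mathbb{R}^n$, with optimal value $d^\star=\sup_\nu\{-f^*(\nu)-g^*(-\nu)\}\in[-\infty,\infty]$.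 (D) is feasible if $0\in\mathrm{dom} f^*+\mathrm{dom} g^*$, strongly infeasible if $0\notin\overline{\mathrm{dom} f^*+\mathrm{dom} g^*}$, and weakly infeasible otherwise. A primal improving direction is a $d\in\mathbb{R}^n$ with $\mathrm{rec} f(d)+\mathrm{rec} g(d)<0$. $\mathrm{Prox}_h(z)=\arg\min_x\{h(x)+\tfrac12\|x-z\|^2\}$. Douglas--Rachford splitting (DRS) with parameter $\gamma>0$ and starting point $z^0\in\mathbb{R}^n$: for $k=0,1,\dots$, $x^{k+1/2}=\mathrm{Prox}_{\gamma f}(z^k)$, $x^{k+1}=\mathrm{Prox}_{\gamma g}(2x^{k+1/2}-z^k)$, $z^{k+1}=z^k+x^{k+1}-x^{k+1/2}$. *)

theory Defs
  imports "HOL-Analysis.Analysis"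
begin

text \<open>
  Functions \<open>f : R^n \<rightarrow> R \<union> {\<infinity>}\<close> are rendered as \<open>ereal\<close>-valued functions; the requirement that
  \<open>-\<infinity>\<close> is never attained is part of \<open>proper_fun\<close>.
\<close>

definition effdom :: "('a \<Rightarrow> ereal) \<Rightarrow> 'a set" where
  "effdom f = {x. f x < \<infinity>}"

definition epi :: "('a \<Rightarrow> ereal) \<Rightarrow> ('a \<times> real) set" where
  "epi f = {(x, t). f x \<le> ereal t}"

definition closed_fun :: "('a::topological_space \<Rightarrow> ereal) \<Rightarrow> bool" where
  "closed_fun f \<longleftrightarrow> closed (epi f)"

definition proper_fun :: "('a \<Rightarrow> ereal) \<Rightarrow> bool" where
  "proper_fun f \<longleftrightarrow> (\<forall>x. f x \<noteq> -\<infinity>) \<and> (\<exists>x. f x < \<infinity>)"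

text \<open>For \<open>u = 0\<close> the convention \<open>0 * \<infinity> = 0\<close> of \<open>ereal\<close> makes the inequality trivial.\<close>

definition convex_fun :: "('a::real_vector \<Rightarrow> ereal) \<Rightarrow> bool" where
  "convex_fun f \<longleftrightarrow>
     (\<forall>x y u v. 0 \<le> u \<longrightarrow> 0 \<le> v \<longrightarrow> u + v = 1 \<longrightarrow>
        f (u *\<^sub>R x + v *\<^sub>R y) \<le> ereal u * f x + ereal v * f y)"

definition conjugate :: "('a::real_inner \<Rightarrow> ereal) \<Rightarrow> 'a \<Rightarrow> ereal" where
  "conjugate f \<nu> = (SUP x. ereal (\<nu> \<bullet> x) - f x)"

text \<open>
  For closed proper convex \<open>f\<close> the limit exists in \<open>ereal\<close> and does not depend on the base point
  \<open>x\<close>, so the description below is well defined.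
\<close>

definition recession :: "('a::real_vector \<Rightarrow> ereal) \<Rightarrow> 'a \<Rightarrow> ereal" where
  "recession f d =
     (THE l. \<forall>x \<in> effdom f.
        ((\<lambda>\<alpha>::real. (f (x + \<alpha> *\<^sub>R d) - f x) / ereal \<alpha>) \<longlongrightarrow> l) at_top)"

definition primal_value :: "('a \<Rightarrow> ereal) \<Rightarrow> ('a \<Rightarrow> ereal) \<Rightarrow> ereal" where
  "primal_value f g = (INF x. f x + g x)"

definition primal_feasible :: "('a \<Rightarrow> ereal) \<Rightarrow> ('a \<Rightarrow> ereal) \<Rightarrow> bool" where
  "primal_feasible f g \<longleftrightarrow> effdom f \<inter> effdom g \<noteq> {}"

definition primal_improving_direction ::
    "('a::real_vector \<Rightarrow> ereal) \<Rightarrow> ('a \<Rightarrow> ereal) \<Rightarrow> 'a \<Rightarrow> bool" where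
  "primal_improving_direction f g d \<longleftrightarrow> recession f d + recession g d < 0"

definition dual_value :: "('a::real_inner \<Rightarrow> ereal) \<Rightarrow> ('a \<Rightarrow> ereal) \<Rightarrow> ereal" where
  "dual_value f g = (SUP \<nu>. - conjugate f \<nu> - conjugate g (- \<nu>))"

text \<open>In the next two definitions \<open>+\<close> is the Minkowski sum of sets.\<close>

definition dual_feasible :: "('a::real_inner \<Rightarrow> ereal) \<Rightarrow> ('a \<Rightarrow> ereal) \<Rightarrow> bool" where
  "dual_feasible f g \<longleftrightarrow> 0 \<in> effdom (conjugate f) + effdom (conjugate g)"

definition dual_strongly_infeasible :: "('a::real_inner \<Rightarrow> ereal) \<Rightarrow> ('a \<Rightarrow> ereal) \<Rightarrow> bool" where
  "dual_strongly_infeasible f g \<longleftrightarrow>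
     0 \<notin> closure (effdom (conjugate f) + effdom (conjugate g))"

definition dual_weakly_infeasible :: "('a::real_inner \<Rightarrow> ereal) \<Rightarrow> ('a \<Rightarrow> ereal) \<Rightarrow> bool" where
  "dual_weakly_infeasible f g \<longleftrightarrow> \<not> dual_feasible f g \<and> \<not> dual_strongly_infeasible f g"

text \<open>The minimiser exists and is unique for closed proper convex \<open>h\<close> on a Euclidean space.\<close>

definition Prox :: "('a::real_normed_vector \<Rightarrow> ereal) \<Rightarrow> 'a \<Rightarrow> 'a" where
  "Prox h z = arg_min (\<lambda>x. h x + ereal (1 / 2 * (norm (x - z))\<^sup>2)) (\<lambda>_. True)"

text \<open>
  \<open>xh k\<close> stands for \<open>x^{k+1/2}\<close> and \<open>x k\<close> for \<open>x^k\<close>; the value \<open>x 0\<close> is not constrained and plays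
  no role in the iteration.
\<close>

definition DRS_iterates ::
    "('a::real_normed_vector \<Rightarrow> ereal) \<Rightarrow> ('a \<Rightarrow> ereal) \<Rightarrow> real \<Rightarrow> 'a
      \<Rightarrow> (nat \<Rightarrow> 'a) \<Rightarrow> (nat \<Rightarrow> 'a) \<Rightarrow> (nat \<Rightarrow> 'a) \<Rightarrow> bool" where
  "DRS_iterates f g \<gamma> z0 xh x z \<longleftrightarrow>
     z 0 = z0 \<and>
     (\<forall>k. xh k = Prox (\<lambda>y. ereal \<gamma> * f y) (z k) \<and>
          x (Suc k) = Prox (\<lambda>y. ereal \<gamma> * g y) (2 *\<^sub>R xh k - z k) \<and>
          z (Suc k) = z k + x (Suc k) - xh k)"

end

theory Submission
  imports Defs
begin

text \<open>
  Everything about the iteration follows from one inequality (\<open>objective_descent\<close>): for every \<open>u\<close> in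
  both domains, the objective value \<open>f(x^{k+1/2}) + g(x^{k+1})\<close> exceeds \<open>f(u) + g(u)\<close> by at most
  \<open>(\<parallel>z^k - u\<parallel>\<^sup>2 - \<parallel>z^{k+1} - u\<parallel>\<^sup>2 - \<parallel>z^k - z^{k+1}\<parallel>\<^sup>2) / 2\<gamma>\<close>. Summed over \<open>k\<close>, it bounds the average
  objective value by \<open>f(u) + g(u) + O(1/k)\<close>. As \<open>p* = -\<infinity>\<close>, the averages tend to \<open>-\<infinity>\<close>, and then so
  does a subsequence of the values. Closed proper convex functions are bounded below on bounded sets,
  so the iterates are unbounded and cannot converge.

  Weak infeasibility is duality. A dual feasible point would make \<open>d* > -\<infinity>\<close>. The recession function
  of \<open>f\<close> is the support function of \<open>dom f*\<close> (\<open>recession_eq_support\<close>), so a hyperplane separating \<open>0\<close>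
  from the closure of \<open>dom f* + dom g*\<close> would yield an improving direction.

  The displacements \<open>z^k - z^{k+1} = x^{k+1/2} - x^{k+1}\<close> vanish because the drift of \<open>z\<close> is sublinear.
  Since (D) is not strongly infeasible, \<open>f\<close> and \<open>g\<close> have affine minorants whose slopes almost cancel,
  so along the at most linearly growing iterates the objective cannot decrease faster than
  \<open>\<epsilon> k\<close>. The summed inequality then gives \<open>\<parallel>z^k - u\<parallel>\<^sup>2 \<le> O(\<epsilon> k\<^sup>2) + O(k)\<close>, thus \<open>\<parallel>z^k\<parallel> = o(k)\<close>. For a
  firmly nonexpansive iteration the norms of the displacements decrease to the asymptotic speed
  \<open>lim \<parallel>z^k\<parallel> / k\<close> (\<open>firmly_nonexpansive_displacement_tendsto_0\<close>), which is therefore \<open>0\<close>.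
\<close>

section \<open>Subgradients and proximal points\<close>

definition subgradient :: "('a::real_inner \<Rightarrow> ereal) \<Rightarrow> 'a \<Rightarrow> 'a \<Rightarrow> bool" where
  "subgradient f x \<nu> \<longleftrightarrow> (\<forall>y. f x + ereal (\<nu> \<bullet> (y - x)) \<le> f y)"

lemma subgradient_monotone:
  assumes "subgradient h p a" "subgradient h q b" "h p = ereal s" "h q = ereal t"
  shows "0 \<le> (a - b) \<bullet> (p - q)"
proof -
  have "s + a \<bullet> (q - p) \<le> t" "t + b \<bullet> (p - q) \<le> s"
    using assms(1)[unfolded subgradient_def, rule_format, of q]
      assms(2)[unfolded subgradient_def, rule_format, of p]
    by (simp_all add: assms(3,4))
  then show ?thesis by (simp add: algebra_simps)
qed

lemma proper_finite_point:
  assumes "proper_fun f"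
  obtains x c where "f x = ereal c"
  using assms unfolding proper_fun_def by (metis ereal_cases less_irrefl)

lemma proper_effdomE:
  assumes "proper_fun f" "x \<in> effdom f"
  obtains c where "f x = ereal c"
  using assms unfolding proper_fun_def effdom_def by (cases "f x") auto

text \<open>
  Closedness keeps \<open>f\<close> above \<open>f x\<^sub>0 - 1\<close> on a small ball around a point \<open>x\<^sub>0\<close> of its domain; along each
  ray from \<open>x\<^sub>0\<close>, convexity then limits the slope with which \<open>f\<close> can decrease outside that ball. This
  elementary bound gives coercivity of the proximal objective and keeps \<open>f\<close> bounded below on bounded
  sets.
\<close>

lemma linear_minorant:
  fixes f :: "'a::real_normed_vector \<Rightarrow> ereal"
  assumes "closed_fun f" "proper_fun f" "convex_fun f"
  obtains c K where "0 \<le> K" "\<And>y. ereal (c - K * norm y) \<le> f y"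
proof -
  obtain x0 c where c: "f x0 = ereal c" using proper_finite_point[OF assms(2)] .
  have "open (- epi f)" using assms(1) by (simp add: closed_fun_def open_Compl)
  moreover have "(x0, c - 1) \<in> - epi f" by (simp add: epi_def c)
  ultimately obtain e where e: "e > 0" "ball (x0, c - 1) e \<subseteq> - epi f"
    by (meson openE)
  define r where "r = e / 2"
  have r: "r > 0" using e by (simp add: r_def)
  have near: "ereal (c - 1) < f y" if "norm (y - x0) \<le> r" for y
  proof -
    have "(y, c - 1) \<in> ball (x0, c - 1) e"
      using that e(1) by (simp add: dist_Pair_Pair dist_norm norm_minus_commute r_def)
    then show ?thesis using e(2) by (force simp: epi_def)
  qed
  have bnd: "ereal (c - 1 - norm (y - x0) / r) \<le> f y" for y
  proof (cases "norm (y - x0) \<le> r")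
    case True
    have "ereal (c - 1 - norm (y - x0) / r) \<le> ereal (c - 1)" using r by simp
    then show ?thesis using near[OF True] by order
  next
    case False
    define s where "s = r / norm (y - x0)"
    have n0: "norm (y - x0) > 0" using False r by linarith
    have s: "0 < s" "s < 1" using False r n0 by (simp_all add: s_def)
    let ?p = "(1 - s) *\<^sub>R x0 + s *\<^sub>R y"
    have "?p - x0 = s *\<^sub>R (y - x0)" by (simp add: algebra_simps)
    then have "norm (?p - x0) = r" using s n0 r by (simp add: s_def)
    then have 1: "ereal (c - 1) < f ?p" using near by simp
    have "f ?p \<le> ereal (1 - s) * f x0 + ereal s * f y"
      using assms(3) s unfolding convex_fun_def by force
    with 1 have 2: "ereal (c - 1) < ereal (1 - s) * f x0 + ereal s * f y" by order
    show ?thesis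
    proof (cases "f y")
      case (real t)
      have "c - 1 < (1 - s) * c + s * t" using 2 by (simp add: c real)
      then have "s * (c - t) < 1" by (simp add: algebra_simps)
      then have "c - t < 1 / s" using s by (simp add: field_simps)
      then show ?thesis using r by (simp add: real s_def)
    next
      case MInf
      then show ?thesis using assms(2) by (simp add: proper_fun_def)
    qed simp
  qed
  show ?thesis
  proof (rule that)
    show "0 \<le> 1 / r" using r by simp
    fix y
    have "norm (y - x0) / r \<le> (norm y + norm x0) / r"
      using r by (intro divide_right_mono norm_triangle_ineq4) auto
    then have "ereal (c - 1 - norm x0 / r - 1 / r * norm y) \<le> ereal (c - 1 - norm (y - x0) / r)"
      by (simp add: add_divide_distrib)
    then show "ereal (c - 1 - norm x0 / r - 1 / r * norm y) \<le> f y" using bnd[of y] by order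
  qed
qed

lemma quadratic_growth_bounded:
  fixes q K D :: real
  assumes "q\<^sup>2 / 2 \<le> D + K * q" "0 \<le> K"
  shows "q \<le> 2 * K + 2 * \<bar>D\<bar> + 1"
proof (rule ccontr)
  assume "\<not> ?thesis"
  then have q: "q > 2 * K + 2 * \<bar>D\<bar> + 1" by simp
  then have "1 \<le> q" using assms(2) by linarith
  then have "1 * (2 * \<bar>D\<bar> + 1) \<le> q * (q - 2 * K)" using q by (intro mult_mono) auto
  then show False using assms(1) by (simp add: power2_eq_square algebra_simps)
qed

text \<open>
  The proximal objective is only lower semicontinuous in \<open>x\<close>, but on the epigraph it becomes the
  continuous function \<open>(x, t) \<mapsto> t + \<parallel>x - z\<parallel>\<^sup>2 / 2\<close>. By the linear minorant its sublevel sets in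
  the epigraph are compact, so it attains its minimum.
\<close>

lemma proximal_minimiser_exists:
  fixes h :: "'a::euclidean_space \<Rightarrow> ereal"
  assumes "closed_fun h" "proper_fun h" "convex_fun h"
  shows "\<exists>u. \<forall>x. h u + ereal (1 / 2 * (norm (u - z))\<^sup>2) \<le> h x + ereal (1 / 2 * (norm (x - z))\<^sup>2)"
proof -
  obtain x0 c where c: "h x0 = ereal c" using proper_finite_point[OF assms(2)] .
  obtain c' K where K: "0 \<le> K" "\<And>y. ereal (c' - K * norm y) \<le> h y"
    using linear_minorant[OF assms] by metis
  define \<phi> where "\<phi> = (\<lambda>p::'a \<times> real. snd p + 1 / 2 * (norm (fst p - z))\<^sup>2)"
  define B where "B = \<phi> (x0, c)"
  define S where "S = epi h \<inter> {p. \<phi> p \<le> B}"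
  have cont: "continuous_on A \<phi>" for A
    unfolding \<phi>_def by (intro continuous_intros)
  define D where "D = B - c' + K * norm z"
  define Q where "Q = 2 * K + 2 * \<bar>D\<bar> + 1"
  have S_sub: "S \<subseteq> cball z Q \<times> {c' - K * (norm z + Q)..B}"
  proof (clarsimp simp: S_def)
    fix y t assume "(y, t) \<in> epi h" and \<phi>: "\<phi> (y, t) \<le> B"
    then have "ereal (c' - K * norm y) \<le> ereal t"
      unfolding epi_def using order_trans[OF K(2)[of y]] by blast
    then have t: "c' - K * norm y \<le> t" by simp
    have "norm y \<le> norm z + norm (y - z)" by (metis norm_triangle_sub)
    then have ny: "K * norm y \<le> K * (norm z + norm (y - z))" using K(1) by (rule mult_left_mono)
    have "(norm (y - z))\<^sup>2 / 2 \<le> D + K * norm (y - z)"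
      using \<phi> t ny by (simp add: \<phi>_def D_def algebra_simps)
    then have yz: "norm (y - z) \<le> Q" unfolding Q_def by (rule quadratic_growth_bounded[OF _ K(1)])
    have "K * (norm z + norm (y - z)) \<le> K * (norm z + Q)"
      using yz K(1) by (intro mult_left_mono) auto
    moreover have "t \<le> B" using \<phi> zero_le_power2[of "norm (y - z)"] unfolding \<phi>_def fst_conv snd_conv by linarith
    ultimately show "dist z y \<le> Q \<and> c' - K * (norm z + Q) \<le> t \<and> t \<le> B"
      using yz t ny by (simp add: dist_norm norm_minus_commute)
  qed
  have "closed {p. \<phi> p \<le> B}"
    using cont continuous_on_const by (rule closed_Collect_le)
  then have "closed S"
    using assms(1) unfolding S_def closed_fun_def by (intro closed_Int)
  then have "compact S"
    using S_sub compact_Times[OF compact_cball compact_Icc]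
    by (metis closed_Int_compact inf.absorb1)
  moreover have x0S: "(x0, c) \<in> S" by (simp add: S_def B_def epi_def c)
  ultimately obtain p where p: "p \<in> S" "\<And>q. q \<in> S \<Longrightarrow> \<phi> p \<le> \<phi> q"
    using continuous_attains_inf[OF _ _ cont, of S] by blast
  obtain u t where ut: "p = (u, t)" by fastforce
  have hu: "h u \<le> ereal t" using p(1) by (simp add: S_def epi_def ut)
  show ?thesis
  proof (intro exI allI)
    fix x
    have "h u + ereal (1 / 2 * (norm (u - z))\<^sup>2) \<le> ereal t + ereal (1 / 2 * (norm (u - z))\<^sup>2)"
      using hu by (rule add_right_mono)
    also have "\<dots> = ereal (\<phi> p)" by (simp add: \<phi>_def ut)
    also have "\<dots> \<le> h x + ereal (1 / 2 * (norm (x - z))\<^sup>2)"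
    proof (cases "h x")
      case (real s)
      have "\<phi> p \<le> \<phi> (x, s)"
      proof (cases "(x, s) \<in> S")
        case False
        then have "B < \<phi> (x, s)" by (simp add: S_def epi_def real)
        then show ?thesis using p(2)[OF x0S] by (simp add: B_def)
      qed (rule p(2))
      then show ?thesis by (simp add: real \<phi>_def)
    next
      case MInf
      then show ?thesis using assms(2) by (simp add: proper_fun_def)
    qed simp
    finally show "h u + ereal (1 / 2 * (norm (u - z))\<^sup>2) \<le> h x + ereal (1 / 2 * (norm (x - z))\<^sup>2)" .
  qed
qed

lemma Prox_minimises:
  fixes h :: "'a::euclidean_space \<Rightarrow> ereal"
  assumes "closed_fun h" "proper_fun h" "convex_fun h"
  shows "h (Prox h z) + ereal (1 / 2 * (norm (Prox h z - z))\<^sup>2)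
           \<le> h x + ereal (1 / 2 * (norm (x - z))\<^sup>2)"
proof -
  have "\<exists>u. is_arg_min (\<lambda>x. h x + ereal (1 / 2 * (norm (x - z))\<^sup>2)) (\<lambda>_. True) u"
    using proximal_minimiser_exists[OF assms, of z] by (simp add: is_arg_min_def not_less)
  then have "is_arg_min (\<lambda>x. h x + ereal (1 / 2 * (norm (x - z))\<^sup>2)) (\<lambda>_. True) (Prox h z)"
    unfolding Prox_def arg_min_def by (rule someI_ex)
  then show ?thesis by (simp add: is_arg_min_def not_less)
qed

lemma Prox_finite:
  fixes h :: "'a::euclidean_space \<Rightarrow> ereal"
  assumes "closed_fun h" "proper_fun h" "convex_fun h"
  shows "\<bar>h (Prox h z)\<bar> \<noteq> \<infinity>"
proof -
  obtain x0 c where "h x0 = ereal c" using proper_finite_point[OF assms(2)] .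
  then have "h (Prox h z) \<noteq> \<infinity>" using Prox_minimises[OF assms, of z x0] by auto
  moreover have "h (Prox h z) \<noteq> - \<infinity>" using assms(2) by (simp add: proper_fun_def)
  ultimately show ?thesis by auto
qed

text \<open>
  Fermat's rule for the proximal problem: compare the minimiser \<open>u\<close> with \<open>u + t (x - u)\<close>, divide by
  \<open>t\<close> and let \<open>t\<close> tend to \<open>0\<close>; the quadratic term contributes only its derivative at \<open>u\<close>.
\<close>

lemma Prox_subgradient:
  fixes h :: "'a::euclidean_space \<Rightarrow> ereal"
  assumes "closed_fun h" "proper_fun h" "convex_fun h"
  shows "subgradient h (Prox h z) (z - Prox h z)"
  unfolding subgradient_def
proof
  fix x
  define u where "u = Prox h z"
  obtain c where c: "h u = ereal c" using Prox_finite[OF assms, of z] unfolding u_def by auto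
  show "h (Prox h z) + ereal ((z - Prox h z) \<bullet> (x - Prox h z)) \<le> h x"
    unfolding u_def[symmetric]
  proof (cases "h x")
    case (real s)
    define R where "R = (norm (x - u))\<^sup>2 / 2"
    have ineq: "c + (z - u) \<bullet> (x - u) \<le> s + t * R" if t: "0 < t" "t < 1" for t
    proof -
      let ?p = "(1 - t) *\<^sub>R u + t *\<^sub>R x"
      have "h ?p \<le> ereal (1 - t) * h u + ereal t * h x"
        using assms(3) t unfolding convex_fun_def by force
      then have hp: "h ?p \<le> ereal ((1 - t) * c + t * s)" by (simp add: c real)
      have "h u + ereal (1 / 2 * (norm (u - z))\<^sup>2) \<le> h ?p + ereal (1 / 2 * (norm (?p - z))\<^sup>2)"
        unfolding u_def by (rule Prox_minimises[OF assms])
      also have "\<dots> \<le> ereal ((1 - t) * c + t * s) + ereal (1 / 2 * (norm (?p - z))\<^sup>2)"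
        using hp by (rule add_right_mono)
      finally have 1: "c + 1 / 2 * (norm (u - z))\<^sup>2 \<le> (1 - t) * c + t * s + 1 / 2 * (norm (?p - z))\<^sup>2"
        by (simp add: c)
      have expand: "(norm (p + t *\<^sub>R q))\<^sup>2 = (norm p)\<^sup>2 + 2 * t * (p \<bullet> q) + t\<^sup>2 * (norm q)\<^sup>2"
        for p q :: 'a
        unfolding power2_norm_eq_inner
        by (simp add: inner_add_left inner_add_right inner_commute power2_eq_square)
      have "?p - z = (u - z) + t *\<^sub>R (x - u)" by (simp add: algebra_simps)
      then have "(norm (?p - z))\<^sup>2
          = (norm (u - z))\<^sup>2 + 2 * t * ((u - z) \<bullet> (x - u)) + t\<^sup>2 * (norm (x - u))\<^sup>2"
        using expand[of "u - z" "x - u"] by (simp only:)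
      also have "(u - z) \<bullet> (x - u) = - ((z - u) \<bullet> (x - u))"
        by (metis inner_minus_left minus_diff_eq)
      finally have "(norm (?p - z))\<^sup>2
          = (norm (u - z))\<^sup>2 - 2 * t * ((z - u) \<bullet> (x - u)) + t\<^sup>2 * (norm (x - u))\<^sup>2"
        by simp
      then have "t * (c + (z - u) \<bullet> (x - u)) \<le> t * (s + t * R)"
        using 1 by (simp add: R_def power2_eq_square[of t] field_simps)
      then show ?thesis using t by simp
    qed
    have "((\<lambda>t. s + t * R) \<longlongrightarrow> s + 0 * R) (at_right 0)"
      by (intro tendsto_intros)
    moreover have "\<forall>\<^sub>F t in at_right 0. c + (z - u) \<bullet> (x - u) \<le> s + t * R"
      unfolding eventually_at_right_field using ineq by (intro exI[of _ 1]) auto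
    ultimately have "c + (z - u) \<bullet> (x - u) \<le> s + 0 * R"
      by (intro tendsto_lowerbound[where F = "at_right 0"]) auto
    then show "h u + ereal ((z - u) \<bullet> (x - u)) \<le> h x" by (simp add: c real)
  next
    case MInf
    then show "h u + ereal ((z - u) \<bullet> (x - u)) \<le> h x" using assms(2) by (simp add: proper_fun_def)
  qed simp
qed

lemma closed_fun_scale:
  fixes f :: "'a::real_normed_vector \<Rightarrow> ereal"
  assumes "closed_fun f" "0 < \<gamma>"
  shows "closed_fun (\<lambda>x. ereal \<gamma> * f x)"
proof -
  have "(ereal \<gamma> * f x \<le> ereal t) = (f x \<le> ereal (t / \<gamma>))" for x t
    using assms(2) by (cases "f x") (auto simp: field_simps)
  then have "epi (\<lambda>x. ereal \<gamma> * f x) = (\<lambda>(x, t). (x, t / \<gamma>)) -` epi f"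
    by (auto simp: epi_def)
  moreover have "closed ((\<lambda>(x, t). (x, t / \<gamma>)) -` epi f)"
    using assms(1) unfolding closed_fun_def case_prod_beta
    by (rule closed_vimage) (use assms(2) in \<open>auto intro!: continuous_intros\<close>)
  ultimately show ?thesis by (simp add: closed_fun_def)
qed

lemma proper_fun_scale:
  assumes "proper_fun f" "0 < \<gamma>"
  shows "proper_fun (\<lambda>x. ereal \<gamma> * f x)"
  using assms unfolding proper_fun_def by (auto simp: ereal_mult_eq_MInfty)

lemma convex_fun_scale:
  assumes "convex_fun f" "0 < \<gamma>"
  shows "convex_fun (\<lambda>x. ereal \<gamma> * f x)"
  unfolding convex_fun_def
proof (intro allI impI)
  fix x y and u v :: real assume uv: "0 \<le> u" "0 \<le> v" "u + v = 1"
  have "f (u *\<^sub>R x + v *\<^sub>R y) \<le> ereal u * f x + ereal v * f y"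
    using assms(1) uv by (simp add: convex_fun_def)
  then have "ereal \<gamma> * f (u *\<^sub>R x + v *\<^sub>R y) \<le> ereal \<gamma> * (ereal u * f x + ereal v * f y)"
    using assms(2) by (intro ereal_mult_left_mono) auto
  also have "\<dots> = ereal u * (ereal \<gamma> * f x) + ereal v * (ereal \<gamma> * f y)"
    using assms(2) by (simp add: ereal_pos_distrib mult.left_commute)
  finally show "ereal \<gamma> * f (u *\<^sub>R x + v *\<^sub>R y)
      \<le> ereal u * (ereal \<gamma> * f x) + ereal v * (ereal \<gamma> * f y)" .
qed

lemma Prox_scaled:
  fixes f :: "'a::euclidean_space \<Rightarrow> ereal"
  assumes "closed_fun f" "proper_fun f" "convex_fun f" "0 < \<gamma>"
    and "u = Prox (\<lambda>y. ereal \<gamma> * f y) z"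
  shows "subgradient f u ((1 / \<gamma>) *\<^sub>R (z - u))"
    and "u \<in> effdom f"
proof -
  note hyps = closed_fun_scale[OF assms(1,4)] proper_fun_scale[OF assms(2,4)]
    convex_fun_scale[OF assms(3,4)]
  have fin: "\<bar>ereal \<gamma> * f u\<bar> \<noteq> \<infinity>" unfolding assms(5) by (rule Prox_finite[OF hyps])
  then obtain c where c: "f u = ereal c" using assms(4) by (cases "f u") auto
  then show "u \<in> effdom f" by (simp add: effdom_def)
  show "subgradient f u ((1 / \<gamma>) *\<^sub>R (z - u))"
    unfolding subgradient_def
  proof
    fix y
    have "ereal \<gamma> * f u + ereal ((z - u) \<bullet> (y - u)) \<le> ereal \<gamma> * f y"
      using Prox_subgradient[OF hyps, of z] unfolding subgradient_def assms(5)[symmetric] by blast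
    moreover have "((1 / \<gamma>) *\<^sub>R (z - u)) \<bullet> (y - u) = ((z - u) \<bullet> (y - u)) / \<gamma>" by simp
    moreover have "ereal \<gamma> * ereal c + ereal w \<le> ereal \<gamma> * f y \<Longrightarrow> ereal c + ereal (w / \<gamma>) \<le> f y" for w
      using assms(4) by (cases "f y") (auto simp: field_simps)
    ultimately show "f u + ereal (((1 / \<gamma>) *\<^sub>R (z - u)) \<bullet> (y - u)) \<le> f y" by (simp only: c)
  qed
qed

section \<open>Recession functions as support functions of conjugate domains\<close>

text \<open>
  An affine minorant can be evaluated, averaged and added pointwise in real arithmetic, so the
  estimates below use this form of \<open>\<nu> \<in> dom f*\<close> rather than the supremum.
\<close>

lemma effdom_conjugate:
  "effdom (conjugate f) = {\<nu>. \<exists>c. \<forall>x. ereal (\<nu> \<bullet> x - c) \<le> f x}"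
proof -
  have "conjugate f \<nu> < \<infinity> \<longleftrightarrow> (\<exists>c. \<forall>x. ereal (\<nu> \<bullet> x - c) \<le> f x)" for \<nu>
  proof -
    have "conjugate f \<nu> < \<infinity> \<longleftrightarrow> (\<exists>c. conjugate f \<nu> \<le> ereal c)"
      by (cases "conjugate f \<nu>") auto
    also have "\<dots> \<longleftrightarrow> (\<exists>c. \<forall>x. ereal (\<nu> \<bullet> x) - f x \<le> ereal c)"
      by (simp add: conjugate_def SUP_le_iff)
    also have "\<dots> \<longleftrightarrow> (\<exists>c. \<forall>x. ereal (\<nu> \<bullet> x - c) \<le> f x)"
    proof -
      have "ereal (\<nu> \<bullet> x) - f x \<le> ereal c \<longleftrightarrow> ereal (\<nu> \<bullet> x - c) \<le> f x" for x c
        by (cases "f x") auto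
      then show ?thesis by simp
    qed
    finally show ?thesis .
  qed
  then show ?thesis by (simp add: effdom_def)
qed

lemma subgradient_in_effdom_conjugate:
  assumes "subgradient f x \<nu>" "f x = ereal c"
  shows "\<nu> \<in> effdom (conjugate f)"
proof -
  have "ereal (\<nu> \<bullet> y - (\<nu> \<bullet> x - c)) \<le> f y" for y
    using assms unfolding subgradient_def by (simp add: inner_diff_right algebra_simps)
  then show ?thesis unfolding effdom_conjugate by blast
qed

lemma convex_effdom_conjugate: "convex (effdom (conjugate f))"
proof (rule convexI)
  fix a b u v assume "a \<in> effdom (conjugate f)" "b \<in> effdom (conjugate f)"
    and uv: "(0::real) \<le> u" "0 \<le> v" "u + v = 1"
  then obtain c d where cd: "\<And>x. ereal (a \<bullet> x - c) \<le> f x" "\<And>x. ereal (b \<bullet> x - d) \<le> f x"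
    unfolding effdom_conjugate by blast
  have "ereal ((u *\<^sub>R a + v *\<^sub>R b) \<bullet> x - (u * c + v * d)) \<le> f x" for x
  proof (cases "f x")
    case (real t)
    have "u * (a \<bullet> x - c) + v * (b \<bullet> x - d) \<le> u * t + v * t"
      using cd[of x] uv by (intro add_mono mult_left_mono) (auto simp: real)
    also have "\<dots> = t" using uv by (metis distrib_right mult_1)
    finally show ?thesis by (simp add: real inner_add_left algebra_simps)
  qed (use cd[of x] in auto)
  then show "u *\<^sub>R a + v *\<^sub>R b \<in> effdom (conjugate f)" unfolding effdom_conjugate by blast
qed

lemma effdom_conjugate_nonempty:
  fixes f :: "'a::euclidean_space \<Rightarrow> ereal"
  assumes "closed_fun f" "proper_fun f" "convex_fun f"
  shows "effdom (conjugate f) \<noteq> {}"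
proof -
  define u where "u = Prox (\<lambda>y. ereal 1 * f y) 0"
  note prox = Prox_scaled[OF assms zero_less_one u_def]
  obtain c where "f u = ereal c" using proper_effdomE[OF assms(2) prox(2)] .
  from subgradient_in_effdom_conjugate[OF prox(1) this] show ?thesis by blast
qed

text \<open>
  The half of \<open>rec f = support function of dom f*\<close> that needs closedness. Let \<open>y = x + \<alpha> d\<close> and let
  \<open>u\<close> be the proximal point of \<open>y\<close> with parameter \<open>\<mu>\<close>. The slope \<open>\<nu> = (y - u) / \<mu>\<close> is a
  subgradient at \<open>u\<close>, hence lies in \<open>dom f*\<close>, and evaluating its minorant at \<open>x\<close> gives
  \<open>f u + \<parallel>y - u\<parallel>\<^sup>2 / \<mu> \<le> f x + \<alpha> s\<close>. As \<open>\<mu>\<close> tends to \<open>0\<close> the points \<open>u\<close> tend to \<open>y\<close>, and the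
  closed epigraph passes the bound on to \<open>y\<close>.
\<close>

lemma recession_upper_bound:
  fixes f :: "'a::euclidean_space \<Rightarrow> ereal"
  assumes "closed_fun f" "proper_fun f" "convex_fun f"
    and bnd: "\<And>\<nu>. \<nu> \<in> effdom (conjugate f) \<Longrightarrow> \<nu> \<bullet> d \<le> s"
    and fx: "f x = ereal c" and \<alpha>: "0 \<le> \<alpha>"
  shows "f (x + \<alpha> *\<^sub>R d) \<le> ereal (c + \<alpha> * s)"
proof (rule ccontr)
  define y where "y = x + \<alpha> *\<^sub>R d"
  define r where "r = c + \<alpha> * s"
  assume "\<not> ?thesis"
  then have "(y, r) \<in> - epi f" by (simp add: epi_def y_def r_def)
  moreover have "open (- epi f)" using assms(1) by (simp add: closed_fun_def open_Compl)
  ultimately obtain e where e: "e > 0" "ball (y, r) e \<subseteq> - epi f" by (meson openE)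
  (* If the claim fails at y, then points near y violate the bound too; but the proximal points
     satisfy it and come arbitrarily close to y. *)
  have far: "e \<le> norm (y - u)" if "f u \<le> ereal r" for u
  proof (rule ccontr)
    assume "\<not> ?thesis"
    then have "(u, r) \<in> ball (y, r) e" by (simp add: dist_Pair_Pair dist_norm)
    then show False using that e(2) by (auto simp: epi_def)
  qed
  obtain c' K where K: "0 \<le> K" "\<And>y. ereal (c' - K * norm y) \<le> f y"
    using linear_minorant[OF assms(1-3)] by metis
  define M where "M = r - c' + K * norm y"
  have key: "\<exists>q\<ge>e. q\<^sup>2 \<le> \<mu> * (M + K * q)" if l: "0 < \<mu>" for \<mu>
  proof -
    define u where "u = Prox (\<lambda>y. ereal \<mu> * f y) y"
    define \<nu> where "\<nu> = (1 / \<mu>) *\<^sub>R (y - u)"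
    have sub: "subgradient f u \<nu>" and u: "u \<in> effdom f"
      unfolding \<nu>_def using Prox_scaled[OF assms(1-3) l u_def] by auto
    obtain t where t: "f u = ereal t" using proper_effdomE[OF assms(2) u] .
    have "\<nu> \<bullet> d \<le> s" by (intro bnd subgradient_in_effdom_conjugate[OF sub t])
    then have ds: "\<alpha> * (\<nu> \<bullet> d) \<le> \<alpha> * s" using \<alpha> by (rule mult_left_mono)
    have "f u + ereal (\<nu> \<bullet> (x - u)) \<le> f x" using sub unfolding subgradient_def by blast
    then have "t + \<nu> \<bullet> (x - u) \<le> c" by (simp add: t fx)
    moreover have "x - u = (y - u) - \<alpha> *\<^sub>R d" by (simp add: y_def)
    ultimately have "t + \<nu> \<bullet> (y - u) \<le> r" using ds by (simp add: r_def inner_diff_right)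
    then have tr: "t + (norm (y - u))\<^sup>2 / \<mu> \<le> r" by (simp add: \<nu>_def power2_norm_eq_inner)
    moreover have "0 \<le> (norm (y - u))\<^sup>2 / \<mu>" using l by simp
    ultimately have "f u \<le> ereal r" by (simp add: t)
    then have "e \<le> norm (y - u)" by (rule far)
    moreover have "(norm (y - u))\<^sup>2 \<le> \<mu> * (M + K * norm (y - u))"
    proof -
      have "c' - K * norm u \<le> t" using K(2)[of u] by (simp add: t)
      moreover have "norm u \<le> norm y + norm (y - u)" by (metis norm_minus_commute norm_triangle_sub)
      then have "K * norm u \<le> K * (norm y + norm (y - u))" using K(1) by (rule mult_left_mono)
      ultimately have "(norm (y - u))\<^sup>2 / \<mu> \<le> M + K * norm (y - u)"
        using tr by (simp add: M_def algebra_simps)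
      then show ?thesis using l by (simp add: field_simps)
    qed
    ultimately show ?thesis by blast
  qed
  (* The parameter is chosen such that the estimate in key forces q to be at most e / 2. *)
  define N where "N = \<bar>M\<bar> + K * e + 1"
  define \<mu> where "\<mu> = e\<^sup>2 / 2 / N"
  have den: "N > 0" using K(1) e(1) by (simp add: N_def add_nonneg_pos)
  then have l: "\<mu> > 0" using e(1) by (simp add: \<mu>_def)
  then obtain q where q: "e \<le> q" "q\<^sup>2 \<le> \<mu> * (M + K * q)" using key by blast
  have "e * (M + K * q) \<le> q * N"
  proof -
    have "e * M \<le> e * \<bar>M\<bar>" using e(1) by (intro mult_left_mono) auto
    also have "\<dots> \<le> q * \<bar>M\<bar>" using q(1) by (intro mult_right_mono) auto
    finally show ?thesis using q(1) e(1) by (simp add: N_def algebra_simps)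
  qed
  then have "\<mu> * (e * (M + K * q)) \<le> \<mu> * (q * N)"
    using l by (intro mult_left_mono) auto
  also have "\<dots> = q * (e\<^sup>2 / 2)" using den by (simp add: \<mu>_def)
  finally have "\<mu> * (e * (M + K * q)) \<le> q * (e\<^sup>2 / 2)" .
  moreover have "e * q\<^sup>2 \<le> e * (\<mu> * (M + K * q))" using q(2) e(1) by (intro mult_left_mono) auto
  ultimately have "(e * q) * q \<le> (e * q) * (e / 2)" by (simp add: power2_eq_square algebra_simps)
  then have "q \<le> e / 2" using q(1) e(1) by (simp add: mult_le_cancel_left_pos)
  then show False using q(1) e(1) by simp
qed

text \<open>
  The difference quotients are squeezed: from below by every affine minorant, whose constant is lost
  after division by \<open>\<alpha>\<close>, and from above by the preceding bound. The limit is visibly the same for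
  all base points, so the description in the definition of \<open>recession\<close> is met by exactly one value.
\<close>

lemma recession_eq_support:
  fixes f :: "'a::euclidean_space \<Rightarrow> ereal"
  assumes "closed_fun f" "proper_fun f" "convex_fun f"
  shows "recession f d = (SUP \<nu>\<in>effdom (conjugate f). ereal (\<nu> \<bullet> d))" (is "_ = ?S")
proof -
  have lim: "((\<lambda>\<alpha>::real. (f (x + \<alpha> *\<^sub>R d) - f x) / ereal \<alpha>) \<longlongrightarrow> ?S) at_top"
    if x: "x \<in> effdom f" for x
  proof (rule order_tendstoI)
    obtain c where c: "f x = ereal c" using proper_effdomE[OF assms(2) x] .
    fix l assume "l < ?S"
    then obtain \<nu> where \<nu>: "\<nu> \<in> effdom (conjugate f)" "l < ereal (\<nu> \<bullet> d)"
      by (auto simp: less_SUP_iff)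
    obtain m where m: "\<And>y. ereal (\<nu> \<bullet> y - m) \<le> f y"
      using \<nu>(1) unfolding effdom_conjugate by blast
    have "((\<lambda>\<alpha>::real. ereal (\<nu> \<bullet> d + (\<nu> \<bullet> x - m - c) / \<alpha>)) \<longlongrightarrow> ereal (\<nu> \<bullet> d + 0)) at_top"
      by (intro tendsto_intros tendsto_divide_0[OF tendsto_const] filterlim_at_top_imp_at_infinity filterlim_ident)
    then have "\<forall>\<^sub>F \<alpha> in at_top. l < ereal (\<nu> \<bullet> d + (\<nu> \<bullet> x - m - c) / \<alpha>)"
      using \<nu>(2) by (intro order_tendstoD(1)) auto
    then show "\<forall>\<^sub>F \<alpha> in at_top. l < (f (x + \<alpha> *\<^sub>R d) - f x) / ereal \<alpha>"
      using eventually_gt_at_top[of "0::real"]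
    proof eventually_elim
      case (elim \<alpha>)
      have "ereal (\<nu> \<bullet> d + (\<nu> \<bullet> x - m - c) / \<alpha>) \<le> (f (x + \<alpha> *\<^sub>R d) - f x) / ereal \<alpha>"
      proof (cases "f (x + \<alpha> *\<^sub>R d)")
        case (real t)
        then have "\<nu> \<bullet> x + \<alpha> * (\<nu> \<bullet> d) - m \<le> t"
          using m[of "x + \<alpha> *\<^sub>R d"] by (simp add: inner_add_right)
        then have "\<nu> \<bullet> d + (\<nu> \<bullet> x - m - c) / \<alpha> \<le> (t - c) / \<alpha>"
          using elim(2) by (simp add: pos_le_divide_eq distrib_left distrib_right mult.commute)
        then show ?thesis using elim(2) by (simp add: real c)
      next
        case PInf
        then show ?thesis using elim(2) by (simp add: c)
      next
        case MInf
        then show ?thesis using assms(2) by (simp add: proper_fun_def)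
      qed
      then show ?case using elim(1) by order
    qed
  next
    obtain c where c: "f x = ereal c" using proper_effdomE[OF assms(2) x] .
    fix a assume "?S < a"
    then obtain s where s: "?S < ereal s" "ereal s < a" using ereal_dense2 by blast
    have "\<nu> \<bullet> d \<le> s" if "\<nu> \<in> effdom (conjugate f)" for \<nu>
    proof -
      have "ereal (\<nu> \<bullet> d) \<le> ereal s"
        using SUP_upper[OF that, of "\<lambda>\<nu>. ereal (\<nu> \<bullet> d)"] s(1) by (rule order_trans[OF _ less_imp_le])
      then show ?thesis by simp
    qed
    then have ub: "f (x + \<alpha> *\<^sub>R d) \<le> ereal (c + \<alpha> * s)" if "0 \<le> \<alpha>" for \<alpha>
      using recession_upper_bound[OF assms _ c that] by blast
    show "\<forall>\<^sub>F \<alpha> in at_top. (f (x + \<alpha> *\<^sub>R d) - f x) / ereal \<alpha> < a"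
      using eventually_gt_at_top[of "0::real"]
    proof eventually_elim
      case (elim \<alpha>)
      have "(f (x + \<alpha> *\<^sub>R d) - f x) / ereal \<alpha> \<le> ereal s"
      proof (cases "f (x + \<alpha> *\<^sub>R d)")
        case (real t)
        then have "(t - c) / \<alpha> \<le> s"
          using ub[of \<alpha>] elim by (simp add: pos_divide_le_eq mult.commute)
        then show ?thesis using elim by (simp add: real c)
      next
        case PInf
        then show ?thesis using ub[of \<alpha>] elim by simp
      next
        case MInf
        then show ?thesis using assms(2) by (simp add: proper_fun_def)
      qed
      then show ?case using s(2) by order
    qed
  qed
  obtain x c where "f x = ereal c" using proper_finite_point[OF assms(2)] .
  then have x: "x \<in> effdom f" by (simp add: effdom_def)
  show ?thesis
    unfolding recession_def
  proof (rule the_equality)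
    fix l
    assume "\<forall>x\<in>effdom f. ((\<lambda>\<alpha>::real. (f (x + \<alpha> *\<^sub>R d) - f x) / ereal \<alpha>) \<longlongrightarrow> l) at_top"
    then have "((\<lambda>\<alpha>::real. (f (x + \<alpha> *\<^sub>R d) - f x) / ereal \<alpha>) \<longlongrightarrow> l) at_top"
      using x by blast
    then show "l = ?S" using lim[OF x] by (rule tendsto_unique[OF trivial_limit_at_top_linorder])
  qed (use lim in blast)
qed

text \<open>
  A hyperplane that strictly separates \<open>0\<close> from the closed convex set \<open>cl (dom f* + dom g*)\<close> has a
  normal \<open>d\<close> at which the two support functions, which are the recession functions, have negative
  sum.
\<close>

lemma strongly_infeasible_imp_improving_direction:
  fixes f g :: "'a::euclidean_space \<Rightarrow> ereal"
  assumes f: "closed_fun f" "proper_fun f" "convex_fun f"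
    and g: "closed_fun g" "proper_fun g" "convex_fun g"
    and "dual_strongly_infeasible f g"
  shows "\<exists>d. primal_improving_direction f g d"
proof -
  let ?A = "effdom (conjugate f)" and ?B = "effdom (conjugate g)"
  have "convex (closure (?A + ?B))"
    by (intro convex_closure convex_set_plus convex_effdom_conjugate)
  moreover have "0 \<notin> closure (?A + ?B)"
    using assms(7) by (simp add: dual_strongly_infeasible_def)
  ultimately obtain e \<beta> where "e \<bullet> 0 < \<beta>" and sep: "\<forall>v\<in>closure (?A + ?B). \<beta> < e \<bullet> v"
    using separating_hyperplane_closed_point[OF _ closed_closure] by blast
  then have \<beta>: "0 < \<beta>" by simp
  define d where "d = - e"
  have ab: "a \<bullet> d + b \<bullet> d \<le> - \<beta>" if "a \<in> ?A" "b \<in> ?B" for a b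
  proof -
    have "a + b \<in> closure (?A + ?B)"
      using closure_subset set_plus_intro[OF that] by (rule subsetD)
    then have "\<beta> < e \<bullet> (a + b)" using sep by blast
    then show ?thesis by (simp add: d_def inner_add_right inner_commute)
  qed
  (* Points of both domains are needed to see that the recession values are finite; otherwise
     their sum could be the meaningless sum of two opposite infinities. *)
  obtain a0 b0 where a0: "a0 \<in> ?A" and b0: "b0 \<in> ?B"
    using effdom_conjugate_nonempty[OF f] effdom_conjugate_nonempty[OF g] by blast
  have rec_f: "recession f d \<le> ereal (- \<beta> - b \<bullet> d)" if "b \<in> ?B" for b
    unfolding recession_eq_support[OF f]
  proof (rule SUP_least)
    fix a assume "a \<in> ?A"
    from ab[OF this that] show "ereal (a \<bullet> d) \<le> ereal (- \<beta> - b \<bullet> d)" by simp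
  qed
  have "ereal (a0 \<bullet> d) \<le> recession f d"
    unfolding recession_eq_support[OF f] using a0 by (rule SUP_upper)
  with rec_f[OF b0] obtain r where r: "recession f d = ereal r"
    by (cases "recession f d") auto
  have "recession g d \<le> ereal (- \<beta> - r)"
    unfolding recession_eq_support[OF g]
  proof (rule SUP_least)
    fix b assume "b \<in> ?B"
    from rec_f[OF this] show "ereal (b \<bullet> d) \<le> ereal (- \<beta> - r)" by (simp add: r)
  qed
  then have "recession f d + recession g d < 0"
    using \<beta> by (cases "recession g d") (auto simp: r)
  then show ?thesis unfolding primal_improving_direction_def by blast
qed

lemma dual_infeasible_if_value_MInf:
  assumes "dual_value f g = - \<infinity>"
  shows "\<not> dual_feasible f g"
proof
  assume "dual_feasible f g"
  then obtain a b where ab: "a \<in> effdom (conjugate f)" "b \<in> effdom (conjugate g)" "a + b = 0"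
    unfolding dual_feasible_def set_plus_def by auto
  then have "b = - a" by (simp add: eq_neg_iff_add_eq_0 add.commute)
  have "- conjugate f a - conjugate g (- a) \<le> dual_value f g"
    unfolding dual_value_def by (rule SUP_upper) simp
  then show False
    using assms ab(1,2) unfolding \<open>b = - a\<close> effdom_def
    by (cases "conjugate f a"; cases "conjugate g (- a)") auto
qed

section \<open>Displacements of firmly nonexpansive iterations\<close>

text \<open>
  The displacements \<open>v k = z k - z (k + 1)\<close> have decreasing norm, with limit \<open>\<delta>\<close> say, and firmness
  makes consecutive ones asymptotically equal. Hence \<open>m\<close> late steps cover a distance of about
  \<open>m \<delta>\<close>, while by nonexpansiveness they cover at most as much as the first \<open>m\<close> steps. So
  \<open>\<parallel>z m - z 0\<parallel> \<ge> m \<delta>\<close> for all \<open>m\<close>, and sublinear drift forces \<open>\<delta> = 0\<close>. In the proof, \<open>L = \<delta>\<^sup>2\<close>.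
\<close>

lemma firmly_nonexpansive_displacement_tendsto_0:
  fixes z :: "nat \<Rightarrow> 'a::real_inner"
  assumes firm: "\<And>i j. (norm (z (Suc i) - z (Suc j)))\<^sup>2
      + (norm ((z i - z (Suc i)) - (z j - z (Suc j))))\<^sup>2 \<le> (norm (z i - z j))\<^sup>2"
    and sublinear: "\<And>\<eta>. \<eta> > 0 \<Longrightarrow> \<exists>m>0. norm (z m - z 0) \<le> \<eta> * real m"
  shows "(\<lambda>k. z k - z (Suc k)) \<longlonglongrightarrow> 0"
proof -
  define v where "v = (\<lambda>k. z k - z (Suc k))"
  define a where "a = (\<lambda>k. (norm (v k))\<^sup>2)"
  have step: "a (Suc k) + (norm (v (Suc k) - v k))\<^sup>2 \<le> a k" for k
    using firm[of k "Suc k"] by (simp add: v_def a_def norm_minus_commute)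
  then have dec: "decseq a"
    by (intro decseq_SucI) (smt (verit) step zero_le_power2)
  moreover have a_nonneg: "0 \<le> a k" for k by (simp add: a_def)
  ultimately obtain L where L: "a \<longlonglongrightarrow> L"
    using decseq_convergent[of a 0] by metis
  have dv: "(\<lambda>k. v (Suc k) - v k) \<longlonglongrightarrow> 0"
  proof -
    have "(\<lambda>k. a k - a (Suc k)) \<longlonglongrightarrow> L - L"
      by (rule tendsto_diff[OF L LIMSEQ_Suc[OF L]])
    then have gap: "(\<lambda>k. a k - a (Suc k)) \<longlonglongrightarrow> 0" by simp
    have "(\<lambda>k. (norm (v (Suc k) - v k))\<^sup>2) \<longlonglongrightarrow> 0"
    proof (rule Lim_null_comparison[OF always_eventually gap], intro allI)
      fix k
      show "norm ((norm (v (Suc k) - v k))\<^sup>2) \<le> a k - a (Suc k)" using step[of k] by simp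
    qed
    then have "(\<lambda>k. sqrt ((norm (v (Suc k) - v k))\<^sup>2)) \<longlonglongrightarrow> sqrt 0" by (rule tendsto_real_sqrt)
    then show ?thesis by (simp add: tendsto_norm_zero_iff)
  qed
  have dvm: "(\<lambda>k. v (k + m) - v k) \<longlonglongrightarrow> 0" for m
  proof (induction m)
    case (Suc m)
    have "(\<lambda>k. (v (Suc (k + m)) - v (k + m)) + (v (k + m) - v k)) \<longlonglongrightarrow> 0 + 0"
      by (intro tendsto_add Suc LIMSEQ_ignore_initial_segment[OF dv, of m])
    then show ?case by simp
  qed simp
  have drift: "(\<lambda>k. z k - z (k + m) - real m *\<^sub>R v k) \<longlonglongrightarrow> 0" for m
  proof (induction m)
    case (Suc m)
    have "(\<lambda>k. (z k - z (k + m) - real m *\<^sub>R v k) + (v (k + m) - v k)) \<longlonglongrightarrow> 0 + 0"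
      by (intro tendsto_add Suc dvm)
    then show ?case by (simp add: v_def algebra_simps)
  qed simp
  have nonexp: "norm (z k - z (k + m)) \<le> norm (z m - z 0)" for k m
  proof (induction k)
    case (Suc k)
    have "(norm (z (Suc k) - z (Suc (k + m))))\<^sup>2 \<le> (norm (z k - z (k + m)))\<^sup>2"
      using firm[of k "k + m"] by (smt (verit) zero_le_power2)
    then have "norm (z (Suc k) - z (Suc (k + m))) \<le> norm (z k - z (k + m))"
      by (rule power2_le_imp_le) simp
    then show ?case using Suc by simp
  qed (simp add: norm_minus_commute)
  have speed: "real m * sqrt L \<le> norm (z m - z 0)" for m
  proof (rule LIMSEQ_le_const2)
    show "(\<lambda>k. real m * norm (v k) - norm (z k - z (k + m) - real m *\<^sub>R v k)) \<longlonglongrightarrow> real m * sqrt L"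
    proof -
      have "(\<lambda>k. sqrt (a k)) \<longlonglongrightarrow> sqrt L" by (intro tendsto_real_sqrt L)
      then have "(\<lambda>k. norm (v k)) \<longlonglongrightarrow> sqrt L" by (simp add: a_def)
      then have "(\<lambda>k. real m * norm (v k) - norm (z k - z (k + m) - real m *\<^sub>R v k))
          \<longlonglongrightarrow> real m * sqrt L - norm (0::'a)"
        by (intro tendsto_diff tendsto_mult tendsto_norm drift tendsto_const)
      then show ?thesis by simp
    qed
    show "\<exists>N. \<forall>k\<ge>N. real m * norm (v k) - norm (z k - z (k + m) - real m *\<^sub>R v k) \<le> norm (z m - z 0)"
    proof (intro exI allI impI)
      fix k
      have "norm (real m *\<^sub>R v k)
          \<le> norm (z k - z (k + m)) + norm (z k - z (k + m) - real m *\<^sub>R v k)"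
        by (metis norm_minus_commute norm_triangle_sub)
      then show "real m * norm (v k) - norm (z k - z (k + m) - real m *\<^sub>R v k) \<le> norm (z m - z 0)"
        using nonexp[of k m] by simp
    qed
  qed
  have "sqrt L \<le> \<eta>" if "\<eta> > 0" for \<eta>
  proof -
    obtain m where m: "m > 0" "norm (z m - z 0) \<le> \<eta> * real m" using sublinear[OF \<open>\<eta> > 0\<close>] by blast
    have "real m * sqrt L \<le> real m * \<eta>"
      using speed[of m] m(2) by (metis mult.commute order_trans)
    then show ?thesis using m(1) by simp
  qed
  then have "sqrt L \<le> 0" by (rule dense_ge)
  moreover have "0 \<le> L" using LIMSEQ_le_const[OF L] a_nonneg by blast
  ultimately have "L = 0" by simp
  then have "(\<lambda>k. sqrt (a k)) \<longlonglongrightarrow> sqrt 0" using L by (intro tendsto_real_sqrt) simp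
  then show ?thesis by (simp add: a_def tendsto_norm_zero_iff v_def)
qed

section \<open>Estimates along the Douglas--Rachford iteration\<close>

locale douglas_rachford =
  fixes f g :: "'a::euclidean_space \<Rightarrow> ereal" and \<gamma> :: real and z0 :: 'a
    and xh x z :: "nat \<Rightarrow> 'a"
  assumes f: "closed_fun f" "proper_fun f" "convex_fun f"
    and g: "closed_fun g" "proper_fun g" "convex_fun g"
    and gamma: "0 < \<gamma>"
    and iterates: "DRS_iterates f g \<gamma> z0 xh x z"
begin

definition objective :: "nat \<Rightarrow> real" where
  "objective k = real_of_ereal (f (xh k) + g (x (Suc k)))"

lemma z_Suc: "z (Suc k) = z k + x (Suc k) - xh k"
  using iterates by (simp add: DRS_iterates_def)

lemma subgradient_f: "subgradient f (xh k) ((1 / \<gamma>) *\<^sub>R (z k - xh k))"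
  and xh_effdom: "xh k \<in> effdom f"
  using Prox_scaled[OF f gamma] iterates by (simp_all add: DRS_iterates_def)

lemma subgradient_g: "subgradient g (x (Suc k)) ((1 / \<gamma>) *\<^sub>R (2 *\<^sub>R xh k - z k - x (Suc k)))"
  and x_effdom: "x (Suc k) \<in> effdom g"
  using Prox_scaled[OF g gamma] iterates by (simp_all add: DRS_iterates_def)

lemma f_real: obtains a where "f (xh k) = ereal a"
  using proper_effdomE[OF f(2) xh_effdom] .

lemma g_real: obtains a where "g (x (Suc k)) = ereal a"
  using proper_effdomE[OF g(2) x_effdom] .

lemma ereal_objective: "ereal (objective k) = f (xh k) + g (x (Suc k))"
  unfolding objective_def by (rule f_real[of k]; rule g_real[of k]) simp

text \<open>
  Adding the two proximal subgradient inequalities at a common point \<open>u\<close>, the inner products collapse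
  to the difference of the squared distances of \<open>z k\<close> and \<open>z (k + 1)\<close> from \<open>u\<close> and the squared
  displacement. The estimate therefore telescopes, and it carries both the statement on averages and that on displacements.
\<close>

lemma objective_descent:
  assumes "f u = ereal p" "g u = ereal q"
  shows "2 * \<gamma> * (objective k - (p + q)) + (norm (z (Suc k) - u))\<^sup>2 + (norm (z k - z (Suc k)))\<^sup>2
           \<le> (norm (z k - u))\<^sup>2"
proof -
  obtain a where a: "f (xh k) = ereal a" by (rule f_real)
  obtain b where b: "g (x (Suc k)) = ereal b" by (rule g_real)
  have value_eq: "objective k = a + b" by (simp add: objective_def a b)
  have "a + ((1 / \<gamma>) *\<^sub>R (z k - xh k)) \<bullet> (u - xh k) \<le> p"
    using subgradient_f[of k, unfolded subgradient_def, rule_format, of u] by (simp add: a assms)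
  then have "\<gamma> * (a + ((1 / \<gamma>) *\<^sub>R (z k - xh k)) \<bullet> (u - xh k)) \<le> \<gamma> * p"
    using gamma by (intro mult_left_mono) auto
  then have 1: "\<gamma> * a + (z k - xh k) \<bullet> (u - xh k) \<le> \<gamma> * p"
    using gamma by (simp add: distrib_left)
  have "b + ((1 / \<gamma>) *\<^sub>R (2 *\<^sub>R xh k - z k - x (Suc k))) \<bullet> (u - x (Suc k)) \<le> q"
    using subgradient_g[of k, unfolded subgradient_def, rule_format, of u] by (simp add: b assms)
  then have "\<gamma> * (b + ((1 / \<gamma>) *\<^sub>R (2 *\<^sub>R xh k - z k - x (Suc k))) \<bullet> (u - x (Suc k))) \<le> \<gamma> * q"
    using gamma by (intro mult_left_mono) auto
  then have 2: "\<gamma> * b + (2 *\<^sub>R xh k - z k - x (Suc k)) \<bullet> (u - x (Suc k)) \<le> \<gamma> * q"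
    using gamma by (simp add: distrib_left)
  have "2 * ((z k - xh k) \<bullet> (u - xh k)) + 2 * ((2 *\<^sub>R xh k - z k - x (Suc k)) \<bullet> (u - x (Suc k)))
      = (norm (z (Suc k) - u))\<^sup>2 + (norm (z k - z (Suc k)))\<^sup>2 - (norm (z k - u))\<^sup>2"
    unfolding z_Suc power2_norm_eq_inner by (simp add: inner_commute algebra_simps)
  with 1 2 show ?thesis by (simp add: value_eq algebra_simps)
qed

lemma objective_sum_bound:
  assumes "f u = ereal p" "g u = ereal q"
  shows "2 * \<gamma> * (\<Sum>i<K. objective i) + (norm (z K - u))\<^sup>2 \<le> 2 * \<gamma> * real K * (p + q) + (norm (z 0 - u))\<^sup>2"
proof (induction K)
  case (Suc K)
  have "2 * \<gamma> * (objective K - (p + q)) + (norm (z (Suc K) - u))\<^sup>2 \<le> (norm (z K - u))\<^sup>2"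
    using objective_descent[OF assms, of K] by (smt (verit) zero_le_power2)
  with Suc show ?case by (simp add: algebra_simps)
qed simp

lemma xh_monotone: "0 \<le> ((z i - xh i) - (z j - xh j)) \<bullet> (xh i - xh j)"
proof -
  obtain a b where "f (xh i) = ereal a" "f (xh j) = ereal b" by (meson f_real)
  from subgradient_monotone[OF subgradient_f subgradient_f this]
  show ?thesis using gamma
    by (simp flip: scaleR_diff_right add: zero_le_divide_iff)
qed

lemma x_monotone:
  "0 \<le> ((2 *\<^sub>R xh i - z i - x (Suc i)) - (2 *\<^sub>R xh j - z j - x (Suc j))) \<bullet> (x (Suc i) - x (Suc j))"
proof -
  obtain a b where "g (x (Suc i)) = ereal a" "g (x (Suc j)) = ereal b" by (meson g_real)
  from subgradient_monotone[OF subgradient_g subgradient_g this]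
  show ?thesis using gamma
    by (simp flip: scaleR_diff_right add: zero_le_divide_iff)
qed

text \<open>
  With \<open>z (k + 1) = z k + x (k + 1) - xh k\<close>, the defect of the inequality is exactly twice the sum of
  the two monotonicity products.
\<close>

lemma firmly_nonexpansive:
  "(norm (z (Suc i) - z (Suc j)))\<^sup>2 + (norm ((z i - z (Suc i)) - (z j - z (Suc j))))\<^sup>2
     \<le> (norm (z i - z j))\<^sup>2"
proof -
  have "(norm (z i - z j))\<^sup>2 - (norm (z (Suc i) - z (Suc j)))\<^sup>2
        - (norm ((z i - z (Suc i)) - (z j - z (Suc j))))\<^sup>2
      = 2 * (((z i - xh i) - (z j - xh j)) \<bullet> (xh i - xh j))
        + 2 * (((2 *\<^sub>R xh i - z i - x (Suc i)) - (2 *\<^sub>R xh j - z j - x (Suc j))) \<bullet> (x (Suc i) - x (Suc j)))"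
    unfolding z_Suc power2_norm_eq_inner by (simp add: inner_commute algebra_simps)
  then show ?thesis using xh_monotone[of i j] x_monotone[of i j] by linarith
qed

lemma displacement_le: "norm (z k - z (Suc k)) \<le> norm (z 0 - z 1)"
proof (induction k)
  case (Suc k)
  have "(norm (z (Suc k) - z (Suc (Suc k))))\<^sup>2 \<le> (norm (z k - z (Suc k)))\<^sup>2"
    using firmly_nonexpansive[of k "Suc k"] by (smt (verit) zero_le_power2)
  then have "norm (z (Suc k) - z (Suc (Suc k))) \<le> norm (z k - z (Suc k))"
    by (rule power2_le_imp_le) simp
  then show ?case using Suc by simp
qed simp

lemma xh_linear_growth: "norm (xh k) \<le> norm (xh 0) + real k * norm (z 0 - z 1)"
proof -
  have z: "norm (z k - z 0) \<le> real k * norm (z 0 - z 1)"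
  proof (induction k)
    case (Suc k)
    have "norm (z (Suc k) - z 0) \<le> norm (z k - z 0) + norm (z k - z (Suc k))"
      by (metis add.commute norm_diff_triangle_le norm_minus_commute order_refl)
    then show ?case using Suc displacement_le[of k] by (simp add: algebra_simps)
  qed simp
  have "(norm (xh k - xh 0))\<^sup>2 \<le> (z k - z 0) \<bullet> (xh k - xh 0)"
    using xh_monotone[of k 0] by (simp add: power2_norm_eq_inner algebra_simps)
  also have "\<dots> \<le> norm (z k - z 0) * norm (xh k - xh 0)" by (rule norm_cauchy_schwarz)
  finally have "norm (xh k - xh 0) \<le> norm (z k - z 0)"
    by (cases "xh k = xh 0") (auto simp: power2_eq_square)
  moreover have "norm (xh k) \<le> norm (xh 0) + norm (xh k - xh 0)" by (rule norm_triangle_sub)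
  ultimately show ?thesis using z by linarith
qed

text \<open>
  The minorants with slopes \<open>a\<close> and \<open>b\<close> are evaluated at the different points \<open>xh k\<close> and \<open>x (k + 1)\<close>.
  These differ by a displacement, which stays bounded, so moving both to \<open>xh k\<close> costs only a constant.
\<close>

lemma objective_lower_bound:
  assumes "a \<in> effdom (conjugate f)" "b \<in> effdom (conjugate g)"
  shows "\<exists>B. \<forall>k. - norm (a + b) * norm (xh k) - B \<le> objective k"
proof -
  obtain c where c: "\<And>y. ereal (a \<bullet> y - c) \<le> f y"
    using assms(1) unfolding effdom_conjugate by blast
  obtain d where d: "\<And>y. ereal (b \<bullet> y - d) \<le> g y"
    using assms(2) unfolding effdom_conjugate by blast
  have "- norm (a + b) * norm (xh k) - (norm b * norm (z 0 - z 1) + c + d) \<le> objective k" for k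
  proof -
    have "ereal (a \<bullet> xh k - c) + ereal (b \<bullet> x (Suc k) - d) \<le> ereal (objective k)"
      unfolding ereal_objective by (intro add_mono c d)
    moreover have "a \<bullet> xh k + b \<bullet> x (Suc k) = (a + b) \<bullet> xh k - b \<bullet> (z k - z (Suc k))"
      by (simp add: z_Suc algebra_simps)
    moreover have "- (norm (a + b) * norm (xh k)) \<le> (a + b) \<bullet> xh k"
      using Cauchy_Schwarz_ineq2[of "a + b" "xh k"] by linarith
    moreover have "b \<bullet> (z k - z (Suc k)) \<le> norm b * norm (z 0 - z 1)"
      by (rule order_trans[OF norm_cauchy_schwarz mult_left_mono[OF displacement_le]]) simp
    ultimately show ?thesis by simp
  qed
  then show ?thesis by blast
qed

text \<open>
  Unless (D) is strongly infeasible there are slopes \<open>a \<in> dom f*\<close>, \<open>b \<in> dom g*\<close> with \<open>\<parallel>a + b\<parallel> < \<epsilon>\<close>, so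
  the objective value at step \<open>k\<close> is at least \<open>- \<epsilon> \<parallel>xh k\<parallel>\<close> up to a constant, and \<open>xh k\<close> grows at most
  linearly in \<open>k\<close>.
  Inserted into the telescoped descent estimate at a primal feasible point this yields
  \<open>\<parallel>z K - z 0\<parallel>\<^sup>2 \<le> A + C K + O(\<epsilon>) K\<^sup>2\<close> with \<open>A\<close> and \<open>C\<close> depending on \<open>\<epsilon>\<close>. Since \<open>\<epsilon>\<close> is arbitrary,
  the drift of \<open>z\<close> is sublinear, which is what the lemma on firmly nonexpansive iterations asks for.
\<close>

lemma displacement_tendsto_0:
  assumes "primal_feasible f g" "\<not> dual_strongly_infeasible f g"
  shows "(\<lambda>k. z k - z (Suc k)) \<longlonglongrightarrow> 0"
proof (rule firmly_nonexpansive_displacement_tendsto_0[of z, OF firmly_nonexpansive])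
  fix \<eta> :: real assume \<eta>: "\<eta> > 0"
  obtain u where "u \<in> effdom f" "u \<in> effdom g"
    using assms(1) by (auto simp: primal_feasible_def)
  then obtain p q where pq: "f u = ereal p" "g u = ereal q"
    by (metis proper_effdomE[OF f(2)] proper_effdomE[OF g(2)])
  define V where "V = norm (z 0 - z 1)"
  define W where "W = V + 1"
  (* With this size the quadratic coefficient 4 * \<gamma> * \<epsilon> * V below is at most half of \<eta>^2; W instead of V
     avoids a division by zero when the iteration is stationary. *)
  define \<epsilon> where "\<epsilon> = \<eta>\<^sup>2 / 8 / \<gamma> / W"
  have V: "0 \<le> V" by (simp add: V_def)
  have \<epsilon>: "\<epsilon> > 0" using \<eta> gamma V by (simp add: \<epsilon>_def W_def)
  obtain s where "s \<in> effdom (conjugate f) + effdom (conjugate g)" "dist s 0 < \<epsilon>"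
    using assms(2) \<epsilon> unfolding dual_strongly_infeasible_def closure_approachable by blast
  then obtain a b where ab: "a \<in> effdom (conjugate f)" "b \<in> effdom (conjugate g)"
    and "norm (a + b) < \<epsilon>" by (auto simp: set_plus_def)
  then obtain B where B: "\<And>k. - norm (a + b) * norm (xh k) - B \<le> objective k"
    using objective_lower_bound by blast
  have lower: "- \<epsilon> * (norm (xh 0) + real K * V) - B \<le> objective k" if "k < K" for k K
  proof -
    have "norm (xh k) \<le> norm (xh 0) + real k * V" unfolding V_def by (rule xh_linear_growth)
    also have "\<dots> \<le> norm (xh 0) + real K * V" using that V by (intro add_mono mult_right_mono) auto
    finally have "norm (a + b) * norm (xh k) \<le> \<epsilon> * (norm (xh 0) + real K * V)"
      using \<open>norm (a + b) < \<epsilon>\<close> \<epsilon> by (intro mult_mono) auto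
    then show ?thesis using B[of k] by simp
  qed
  define C where "C = 4 * \<gamma> * (p + q + \<epsilon> * norm (xh 0) + B)"
  define A where "A = 4 * (norm (z 0 - u))\<^sup>2"
  have quad: "(norm (z K - z 0))\<^sup>2 \<le> A + C * real K + \<eta>\<^sup>2 / 2 * (real K)\<^sup>2" for K
  proof -
    have "real (card {..<K}) * (- \<epsilon> * (norm (xh 0) + real K * V) - B) \<le> (\<Sum>i<K. objective i)"
      by (rule sum_bounded_below, rule lower) simp
    then have "real K * (- \<epsilon> * (norm (xh 0) + real K * V) - B) \<le> (\<Sum>i<K. objective i)"
      by (simp only: card_lessThan)
    then have "2 * \<gamma> * (real K * (- \<epsilon> * (norm (xh 0) + real K * V) - B)) \<le> 2 * \<gamma> * (\<Sum>i<K. objective i)"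
      using gamma by (intro mult_left_mono) auto
    with objective_sum_bound[OF pq, of K]
    have 1: "2 * (norm (z K - u))\<^sup>2
        \<le> 2 * (norm (z 0 - u))\<^sup>2 + C * real K + 4 * \<gamma> * \<epsilon> * V * (real K)\<^sup>2"
      by (simp add: C_def algebra_simps power2_eq_square)
    have "4 * \<gamma> * \<epsilon> * V = \<eta>\<^sup>2 / 2 * (V / W)"
      using gamma by (simp add: \<epsilon>_def)
    also have "\<dots> \<le> \<eta>\<^sup>2 / 2 * 1"
      by (rule mult_left_mono) (use V in \<open>simp_all add: W_def\<close>)
    finally have "4 * \<gamma> * \<epsilon> * V \<le> \<eta>\<^sup>2 / 2" by simp
    then have "4 * \<gamma> * \<epsilon> * V * (real K)\<^sup>2 \<le> \<eta>\<^sup>2 / 2 * (real K)\<^sup>2"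
      by (rule mult_right_mono) simp
    moreover have "(norm (z K - z 0))\<^sup>2 \<le> 2 * (norm (z K - u))\<^sup>2 + 2 * (norm (z 0 - u))\<^sup>2"
    proof -
      have "norm (z K - z 0) \<le> norm (z K - u) + norm (z 0 - u)"
        using norm_triangle_ineq4[of "z K - u" "z 0 - u"] by simp
      then have "(norm (z K - z 0))\<^sup>2 \<le> (norm (z K - u) + norm (z 0 - u))\<^sup>2"
        by (rule power_mono) simp
      also have "\<dots> \<le> 2 * (norm (z K - u))\<^sup>2 + 2 * (norm (z 0 - u))\<^sup>2"
        using zero_le_power2[of "norm (z K - u) - norm (z 0 - u)"]
        by (simp add: power2_eq_square algebra_simps)
      finally show ?thesis .
    qed
    ultimately show ?thesis using 1 by (simp add: A_def)
  qed
  have A: "0 \<le> A" by (simp add: A_def)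
  obtain m where m: "2 * (A + \<bar>C\<bar> + 1) / \<eta>\<^sup>2 < real m" using reals_Archimedean2 by blast
  have "0 < 2 * (A + \<bar>C\<bar> + 1) / \<eta>\<^sup>2" using A \<eta> by simp
  then have m0: "0 < real m" using m by linarith
  then have m1: "1 \<le> real m" by simp
  have "A + C * real m \<le> A * real m + \<bar>C\<bar> * real m"
    using A m1 by (intro add_mono mult_right_mono) (auto simp: mult_le_cancel_left1)
  also have "\<dots> \<le> (A + \<bar>C\<bar> + 1) * real m" by (simp add: algebra_simps)
  also have "\<dots> \<le> (\<eta>\<^sup>2 / 2 * real m) * real m"
    using m \<eta> by (intro mult_right_mono) (auto simp: field_simps)
  finally have "(norm (z m - z 0))\<^sup>2 \<le> (\<eta> * real m)\<^sup>2"
    using quad[of m] by (simp add: power2_eq_square algebra_simps)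
  then have "norm (z m - z 0) \<le> \<eta> * real m"
    by (rule power2_le_imp_le) (use \<eta> in simp)
  then show "\<exists>m>0. norm (z m - z 0) \<le> \<eta> * real m" using m0 by auto
qed

lemma average_objective:
  "ereal (1 / (real k + 1)) * (\<Sum>i=0..k. f (xh i) + g (x (Suc i)))
     = ereal (1 / (real k + 1) * (\<Sum>i<Suc k. objective i))"
  unfolding ereal_objective[symmetric] sum_ereal times_ereal.simps(1) atLeast0AtMost lessThan_Suc_atMost ..

text \<open>
  By the telescoped descent estimate the average exceeds \<open>f u + g u\<close> by at most \<open>O(1 / k)\<close>, for every
  \<open>u\<close> in both domains; and these values are unbounded below.
\<close>

lemma objective_average_tendsto_MInf:
  assumes "primal_value f g = - \<infinity>"
  shows "(\<lambda>k. ereal (1 / (real k + 1)) * (\<Sum>i=0..k. f (xh i) + g (x (Suc i)))) \<longlonglongrightarrow> - \<infinity>"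
proof -
  have "\<forall>\<^sub>F k in sequentially. ereal (1 / (real k + 1) * (\<Sum>i<Suc k. objective i)) < ereal r" for r
  proof -
    have "primal_value f g < ereal (r - 1)" using assms by simp
    then obtain u where u: "f u + g u < ereal (r - 1)"
      by (auto simp: primal_value_def INF_less_iff)
    moreover have "f u \<noteq> - \<infinity>" "g u \<noteq> - \<infinity>" using f(2) g(2) by (simp_all add: proper_fun_def)
    ultimately obtain p q where pq: "f u = ereal p" "g u = ereal q"
      by (cases "f u"; cases "g u") auto
    with u have r: "p + q < r - 1" by simp
    have divide: "1 / n * s \<le> r + w / n" if "s \<le> n * r + w" "0 < n" for s n r w :: real
      using that by (simp add: field_simps)
    have bound: "1 / (real k + 1) * (\<Sum>i<Suc k. objective i) \<le> p + q + ((norm (z 0 - u))\<^sup>2 / (2 * \<gamma>)) / real (Suc k)" for k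
    proof -
      have "2 * \<gamma> * (\<Sum>i<Suc k. objective i) \<le> 2 * \<gamma> * real (Suc k) * (p + q) + (norm (z 0 - u))\<^sup>2"
        using objective_sum_bound[OF pq, of "Suc k"] by (smt (verit) zero_le_power2)
      then have "(\<Sum>i<Suc k. objective i) \<le> real (Suc k) * (p + q) + (norm (z 0 - u))\<^sup>2 / (2 * \<gamma>)"
        using gamma by (simp add: field_simps)
      from divide[OF this] show ?thesis by (simp add: add.commute)
    qed
    have "(\<lambda>k. p + q + ((norm (z 0 - u))\<^sup>2 / (2 * \<gamma>)) / real (Suc k)) \<longlonglongrightarrow> p + q + 0"
      by (rule tendsto_add[OF tendsto_const LIMSEQ_Suc[OF lim_const_over_n]])
    then have "\<forall>\<^sub>F k in sequentially. p + q + ((norm (z 0 - u))\<^sup>2 / (2 * \<gamma>)) / real (Suc k) < r"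
      using r by (intro order_tendstoD(2)) auto
    then show ?thesis by eventually_elim (use bound in \<open>auto intro: le_less_trans\<close>)
  qed
  then show ?thesis unfolding average_objective tendsto_MInfty by blast
qed

lemma objective_not_bounded_below:
  assumes "primal_value f g = - \<infinity>"
  shows "\<not> (\<forall>\<^sub>F k in sequentially. ereal m \<le> f (xh k) + g (x (Suc k)))"
proof
  assume "\<forall>\<^sub>F k in sequentially. ereal m \<le> f (xh k) + g (x (Suc k))"
  then obtain N where N: "\<And>k. N \<le> k \<Longrightarrow> m \<le> objective k"
    unfolding ereal_objective[symmetric] ereal_less_eq(3) eventually_sequentially by blast
  define m' where "m' = Min (insert m (objective ` {..<N}))"
  have m': "m' \<le> objective k" for k
  proof (cases "k < N")
    case False
    then have "m' \<le> m" "m \<le> objective k" using N by (auto simp: m'_def)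
    then show ?thesis by (rule order_trans)
  qed (auto simp: m'_def)
  have "ereal m' \<le> ereal (1 / (real k + 1)) * (\<Sum>i=0..k. f (xh i) + g (x (Suc i)))" for k
  proof -
    have "real (card {..<Suc k}) * m' \<le> (\<Sum>i<Suc k. objective i)"
      by (rule sum_bounded_below) (rule m')
    then have "m' \<le> 1 / (real k + 1) * (\<Sum>i<Suc k. objective i)"
      by (simp add: pos_le_divide_eq mult.commute add.commute)
    then show ?thesis unfolding average_objective by simp
  qed
  then have "ereal m' \<le> - \<infinity>"
    using LIMSEQ_le_const[OF objective_average_tendsto_MInf[OF assms]] by blast
  then show False by simp
qed

lemma objective_liminf_MInf:
  assumes "primal_value f g = - \<infinity>"
  shows "liminf (\<lambda>k. f (xh k) + g (x (Suc k))) = - \<infinity>"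
proof (rule ccontr)
  assume "\<not> ?thesis"
  then obtain m where "ereal m < liminf (\<lambda>k. f (xh k) + g (x (Suc k)))"
    using ereal_dense2[of "- \<infinity>"] by (metis ereal_infty_less(2))
  then have "\<forall>\<^sub>F k in sequentially. ereal m < f (xh k) + g (x (Suc k))"
    by (rule less_LiminfD)
  then have "\<forall>\<^sub>F k in sequentially. ereal m \<le> f (xh k) + g (x (Suc k))"
    by eventually_elim simp
  then show False using objective_not_bounded_below[OF assms] by blast
qed

text \<open>
  On bounded sets both functions are bounded below by their linear minorants, so bounded iterates
  would keep the objective from falling to \<open>-\<infinity>\<close>.
\<close>

lemma iterates_unbounded:
  assumes "primal_value f g = - \<infinity>"
  shows "\<not> bounded (range (\<lambda>k. (xh k, x (Suc k))))"
proof
  assume "bounded (range (\<lambda>k. (xh k, x (Suc k))))"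
  then obtain R where R: "\<And>k. norm (xh k, x (Suc k)) \<le> R" by (auto simp: bounded_iff)
  obtain c K where K: "0 \<le> K" "\<And>y. ereal (c - K * norm y) \<le> f y"
    using linear_minorant[OF f] by metis
  obtain d J where J: "0 \<le> J" "\<And>y. ereal (d - J * norm y) \<le> g y"
    using linear_minorant[OF g] by metis
  have "ereal ((c - K * R) + (d - J * R)) \<le> f (xh k) + g (x (Suc k))" for k
  proof -
    have "norm (xh k) \<le> R" "norm (x (Suc k)) \<le> R"
      using R[of k] norm_fst_le[of "xh k" "x (Suc k)"] norm_snd_le[of "x (Suc k)" "xh k"] by linarith+
    then have "ereal ((c - K * R) + (d - J * R))
        \<le> ereal (c - K * norm (xh k)) + ereal (d - J * norm (x (Suc k)))"
      using K(1) J(1) by (simp add: add_mono mult_left_mono diff_mono)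
    also have "\<dots> \<le> f (xh k) + g (x (Suc k))" by (intro add_mono K J)
    finally show ?thesis .
  qed
  then have "\<forall>\<^sub>F k in sequentially.
      ereal ((c - K * R) + (d - J * R)) \<le> f (xh k) + g (x (Suc k))"
    by (intro always_eventually allI)
  then show False using objective_not_bounded_below[OF assms] by contradiction
qed

end

section \<open>The weakly infeasible case\<close>

theorem theorem8:
  fixes f g :: "real ^ 'n \<Rightarrow> ereal"
    and \<gamma> :: real
    and z0 :: "real ^ 'n"
    and xh x z :: "nat \<Rightarrow> real ^ 'n"
  assumes "closed_fun f" "proper_fun f" "convex_fun f"
    and "closed_fun g" "proper_fun g" "convex_fun g"
    and "\<gamma> > 0"
    and "DRS_iterates f g \<gamma> z0 xh x z"
    and "dual_value f g = primal_value f g" "primal_value f g = -\<infinity>"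
    and "primal_feasible f g"
    and "\<not> (\<exists>d. primal_improving_direction f g d)"
  shows "dual_weakly_infeasible f g
    \<and> (\<lambda>k. x (Suc k) - xh k) \<longlonglongrightarrow> 0
    \<and> (\<lambda>k. ereal (1 / (real k + 1)) * (\<Sum>i=0..k. f (xh i) + g (x (Suc i)))) \<longlonglongrightarrow> -\<infinity>
    \<and> liminf (\<lambda>k. f (xh k) + g (x (Suc k))) = -\<infinity>
    \<and> \<not> convergent (\<lambda>k. (xh k, x (Suc k)))"
proof -
  interpret douglas_rachford f g \<gamma> z0 xh x z
    by (rule douglas_rachford.intro) (fact assms)+
  have not_strong: "\<not> dual_strongly_infeasible f g"
    using strongly_infeasible_imp_improving_direction[OF f g] assms(12) by blast
  moreover have "\<not> dual_feasible f g"
    using assms(9,10) by (intro dual_infeasible_if_value_MInf) simp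
  moreover have "(\<lambda>k. x (Suc k) - xh k) \<longlonglongrightarrow> 0"
    using tendsto_minus[OF displacement_tendsto_0[OF assms(11) not_strong]] by (simp add: z_Suc)
  moreover have "\<not> convergent (\<lambda>k. (xh k, x (Suc k)))"
    using iterates_unbounded[OF assms(10)]
    by (rule contrapos_nn) (auto simp: convergent_def intro: convergent_imp_bounded)
  ultimately show ?thesis
    using objective_average_tendsto_MInf[OF assms(10)] objective_liminf_MInf[OF assms(10)]
    by (simp add: dual_weakly_infeasible_def)
qed

end
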